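(* Let $D$ be a minimal strong digraph, let $C_q$ be a directed cycle of length $q\ge 2$ contained in $D$, and let $D'$ be the digraph obtained from $D$ by deleting all arcs of $C_q$ (keeping all vertices). Then every non-trivial strong component $S$ of $D'$ that contains at most one vertex of $C_q$ contains at least one vertex which is a linear vertex of $D$.
   Context: A digraph is strongly connected (strong) if every vertex can reach every other by a directed path. An arc $uv$ of a digraph is transitive if there is another directed $uv$-path not using the arc $uv$. A minimal strong digraph (MSD) is a strongly connected digraph with no transitive arcs (equivalently, deleting any arc destroys strong connectivity). A strong component (SC) is a maximal strongly connected subdigraph; it is trivial if it has only one vertex. A vertex $v$ of $D$ is linear if its indegree and outdegree in $D$ are both equal to $1$. All cycles and paths are directed. *)

theory Defs
  imports "Graph_Theory.Graph_Theory"
begin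

definition transitive_arc :: "('a, 'b) pre_digraph \<Rightarrow> 'b \<Rightarrow> bool" where
  "transitive_arc G e \<longleftrightarrow>
     e \<in> arcs G \<and> (\<exists>p. pre_digraph.apath G (tail G e) p (head G e) \<and> e \<notin> set p)"

text \<open>The locale predicate \<open>digraph\<close> requires finiteness and excludes loops and parallel arcs.\<close>

definition minimal_strong_digraph :: "('a, 'b) pre_digraph \<Rightarrow> bool" where
  "minimal_strong_digraph G \<longleftrightarrow>
     digraph G \<and> strongly_connected G \<and> \<not> (\<exists>e \<in> arcs G. transitive_arc G e)"

definition linear_vertex :: "('a, 'b) pre_digraph \<Rightarrow> 'a \<Rightarrow> bool" where
  "linear_vertex G v \<longleftrightarrow> v \<in> verts G \<and> in_degree G v = 1 \<and> out_degree G v = 1"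

definition del_arcs :: "('a, 'b) pre_digraph \<Rightarrow> 'b set \<Rightarrow> ('a, 'b) pre_digraph" where
  "del_arcs G A = \<lparr> verts = verts G, arcs = arcs G - A, tail = tail G, head = head G \<rparr>"

abbreviation strong_component :: "('a, 'b) pre_digraph \<Rightarrow> ('a, 'b) pre_digraph \<Rightarrow> bool" where
  "strong_component G S \<equiv> pre_digraph.max_subgraph G strongly_connected S"

definition nontrivial :: "('a, 'b) pre_digraph \<Rightarrow> bool" where
  "nontrivial S \<longleftrightarrow> card (verts S) \<noteq> 1"

text \<open>A cycle is given by its list of arcs; every vertex of it is the tail of one of them.\<close>

definition cycle_verts :: "('a, 'b) pre_digraph \<Rightarrow> 'b list \<Rightarrow> 'a set" where
  "cycle_verts G c = tail G ` set c"

end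

theory Submission
  imports Defs
begin

text \<open>
  Let \<open>K\<close> be the vertex set of \<open>S\<close>. Since \<open>S\<close> is a strong component after the deletion, every arc
  leaving \<open>K\<close> leads to the cycle, and every arc entering \<open>K\<close> comes from it, without using arcs
  inside \<open>K\<close>; hence every exit of \<open>K\<close> is joined to every entry of \<open>K\<close> outside of \<open>K\<close>. For any strong
  set \<open>K\<close> with this property, induct on its size. Let \<open>L\<close> be a maximal strong proper subset. Then
  \<open>K\<close> consists of \<open>L\<close> and one ear, and the inner vertices of the ear are linear within \<open>K\<close>. If none
  of them is linear in the digraph, all are exits or entries of \<open>K\<close>. In the cyclic sequence formed by
  \<open>L\<close> and the inner vertices of the ear, no member with an exit is followed by one with an entry,
  since the arc between them would be transitive. So if \<open>L\<close> contained an exit or an entry, \<open>K\<close>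
  would have no entry or no exit at all. Hence \<open>L\<close> is attached to the rest only by the ear, and it
  is a linear vertex or the induction hypothesis applies to it.
\<close>

section \<open>Strong sets and ears\<close>

definition strong_on :: "('a \<times> 'a) set \<Rightarrow> 'a set \<Rightarrow> bool" where
  "strong_on E K \<longleftrightarrow> (\<forall>u\<in>K. \<forall>v\<in>K. (u, v) \<in> (E \<inter> K \<times> K)\<^sup>*)"

text \<open>The ends may coincide and inner vertices may repeat; distinctness comes later, from
  choosing a shortest ear. The bound \<open>2 \<le> n\<close> forces an inner vertex.\<close>

definition ear :: "('a \<times> 'a) set \<Rightarrow> 'a set \<Rightarrow> 'a set \<Rightarrow> nat \<Rightarrow> (nat \<Rightarrow> 'a) \<Rightarrow> bool" where
  "ear E K L n f \<longleftrightarrow> 2 \<le> n \<and> f 0 \<in> L \<and> f n \<in> L \<and> (\<forall>i. 0 < i \<and> i < n \<longrightarrow> f i \<in> K - L)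
     \<and> (\<forall>i<n. (f i, f (Suc i)) \<in> E)"

lemma path_first_hit:
  assumes "(x, y) \<in> (E \<inter> K \<times> K)\<^sup>*" "y \<in> L" "x \<in> K"
  shows "\<exists>n f. f 0 = x \<and> f n \<in> L \<and> (\<forall>i<n. f i \<in> K - L \<and> (f i, f (Suc i)) \<in> E)"
  using assms
proof (induction rule: converse_rtrancl_induct)
  case base
  then show ?case by (intro exI[of _ 0] exI[of _ "\<lambda>_. y"]) auto
next
  case (step x z)
  then obtain n f where f: "f 0 = z" "f n \<in> L" "\<forall>i<n. f i \<in> K - L \<and> (f i, f (Suc i)) \<in> E"
    by auto
  show ?case
  proof (cases "x \<in> L")
    case True
    then show ?thesis by (intro exI[of _ 0] exI[of _ "\<lambda>_. x"]) auto
  next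
    case False
    \<comment> \<open>\<open>case_nat x f\<close> is the sequence \<open>f\<close> with
      \<open>x\<close> put in front.\<close>
    have "\<forall>i<Suc n. case_nat x f i \<in> K - L \<and> (case_nat x f i, case_nat x f (Suc i)) \<in> E"
      using f step False by (auto split: nat.split)
    then show ?thesis using f by (intro exI[of _ "Suc n"] exI[of _ "case_nat x f"]) auto
  qed
qed

lemma path_crosses:
  assumes "(x, y) \<in> R\<^sup>*" "x \<in> A" "y \<notin> A"
  shows "\<exists>u v. (u, v) \<in> R \<and> u \<in> A \<and> v \<notin> A"
  using assms by (induction rule: rtrancl_induct) blast+

text \<open>An arc leaving \<open>L\<close> inside \<open>K\<close> is continued by a path in
  \<open>K\<close> back to its tail, stopped at the first vertex in \<open>L\<close>.\<close>

lemma ear_exists: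
  assumes "strong_on E K" "L \<subset> K" "L \<noteq> {}"
  shows "\<exists>n f. ear E K L n f"
proof -
  obtain x y where xy: "x \<in> L" "y \<in> K" "y \<notin> L" using assms by blast
  then have "(x, y) \<in> (E \<inter> K \<times> K)\<^sup>*" using assms unfolding strong_on_def by blast
  from path_crosses[OF this xy(1,3)] obtain b r
    where br: "(b, r) \<in> E" "b \<in> L" "r \<in> K" "r \<notin> L" by blast
  then have "(r, b) \<in> (E \<inter> K \<times> K)\<^sup>*" using assms unfolding strong_on_def by blast
  from path_first_hit[OF this br(2,3)] obtain n f
    where f: "f 0 = r" "f n \<in> L" "\<forall>i<n. f i \<in> K - L \<and> (f i, f (Suc i)) \<in> E" by blast
  have "n \<noteq> 0" using f br by (metis)
  then have "ear E K L (Suc n) (case_nat b f)"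
    using f br unfolding ear_def by (auto split: nat.split)
  then show ?thesis by blast
qed

text \<open>The closed piece between two equal inner vertices is cut out. As \<open>i\<close> and
  \<open>j\<close> are inner positions, at least two arcs remain.\<close>

lemma ear_shortcut:
  assumes e: "ear E K L n f" and ij: "0 < i" "i < j" "j < n" "f i = f j"
  shows "\<exists>m<n. \<exists>g. ear E K L m g"
proof (intro exI conjI)
  let ?m = "n - (j - i)"
  show "?m < n" using ij by auto
  show "ear E K L ?m (\<lambda>k. if k \<le> i then f k else f (k + (j - i)))"
    unfolding ear_def
  proof (intro conjI allI impI)
    fix k assume k: "k < ?m"
    show "(if k \<le> i then f k else f (k + (j - i)),
           if Suc k \<le> i then f (Suc k) else f (Suc k + (j - i))) \<in> E"
    proof (cases "k = i")
      case True
      then have "(f j, f (Suc j)) \<in> E" using e ij unfolding ear_def by auto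
      then show ?thesis using True ij by auto
    next
      case False
      then show ?thesis using e ij k unfolding ear_def by auto
    qed
  qed (use e ij in \<open>auto simp: ear_def\<close>)
qed

text \<open>Every vertex reaches \<open>f 0\<close> and is reached from it: the ear leads on to
  \<open>f n\<close>, and \<open>L\<close> connects \<open>f n\<close> with \<open>f 0\<close>.
  Keeping \<open>A\<close> explicit lets arcs outside \<open>A\<close> be recognised later as
  bypassed.\<close>

lemma ear_arcs_strong:
  assumes e: "ear E K L n f" and L: "strong_on E L"
    and A: "E \<inter> L \<times> L \<subseteq> A" "\<And>i. i < n \<Longrightarrow> (f i, f (Suc i)) \<in> A"
    and u: "u \<in> L \<union> f ` {..n}" and v: "v \<in> L \<union> f ` {..n}"
  shows "(u, v) \<in> A\<^sup>*"
proof -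
  have LL: "(x, y) \<in> A\<^sup>*" if "x \<in> L" "y \<in> L" for x y
    using that L rtrancl_mono[OF A(1)] unfolding strong_on_def by blast
  have ends: "f 0 \<in> L" "f n \<in> L" using e by (auto simp: ear_def)
  have seg: "(f i, f j) \<in> A\<^sup>*" if "i \<le> j" "j \<le> n" for i j
    using that
  proof (induction j rule: dec_induct)
    case (step j)
    then show ?case using A(2)[of j] by (auto intro: rtrancl_into_rtrancl)
  qed auto
  have "(u, f 0) \<in> A\<^sup>*"
    using u LL ends seg by (auto intro: rtrancl_trans[of _ "f n"])
  moreover have "(f 0, v) \<in> A\<^sup>*"
    using v LL ends seg by auto
  ultimately show ?thesis by (rule rtrancl_trans)
qed

lemma maximal_strong_proper_subset:
  assumes "finite K" "2 \<le> card K"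
  obtains L where "L \<subset> K" "L \<noteq> {}" "strong_on E L"
    "\<And>M. L \<subset> M \<Longrightarrow> M \<subseteq> K \<Longrightarrow> strong_on E M \<Longrightarrow> M = K"
proof -
  let ?F = "{L. L \<subset> K \<and> L \<noteq> {} \<and> strong_on E L}"
  have fin: "finite ?F" using assms by (auto intro: finite_subset[of _ "Pow K"])
  obtain x where "x \<in> K" using assms by fastforce
  moreover have "K \<noteq> {x}" using assms by auto
  ultimately have "{x} \<in> ?F" by (auto simp: strong_on_def)
  then obtain L where L: "L \<in> ?F" "\<forall>M\<in>?F. L \<subseteq> M \<longrightarrow> L = M"
    using finite_has_maximal[OF fin] by blast
  then show ?thesis by (intro that[of L]) blast+
qed

section \<open>Exits, entries and the induction\<close>

definition exits :: "('a \<times> 'a) set \<Rightarrow> 'a set \<Rightarrow> 'a set" where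
  "exits E K = {u \<in> K. \<exists>w. w \<notin> K \<and> (u, w) \<in> E}"

definition entries :: "('a \<times> 'a) set \<Rightarrow> 'a set \<Rightarrow> 'a set" where
  "entries E K = {v \<in> K. \<exists>w. w \<notin> K \<and> (w, v) \<in> E}"

text \<open>A bare relation and an arbitrary \<open>K\<close> are used because the induction passes
  to \<open>L\<close>, which need not be a strong component after the deletion. As the closure in
  \<open>nontrans\<close> is reflexive, loops are excluded too.\<close>

lemma strong_set_has_linear_vertex:
  fixes E :: "('a \<times> 'a) set"
  assumes nontrans: "\<And>u v. (u, v) \<in> E \<Longrightarrow> (u, v) \<notin> (E - {(u, v)})\<^sup>*"
    and "finite K" "2 \<le> card K" "strong_on E K"
    and "exits E K \<noteq> {}" "entries E K \<noteq> {}"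
    and "\<And>u v. u \<in> exits E K \<Longrightarrow> v \<in> entries E K \<Longrightarrow> (u, v) \<in> (E - K \<times> K)\<^sup>*"
  shows "\<exists>v\<in>K. (\<exists>!w. (v, w) \<in> E) \<and> (\<exists>!w. (w, v) \<in> E)"
  using assms(2-)
proof (induction "card K" arbitrary: K rule: less_induct)
  case less
  note fin = less.prems(1) and strong = less.prems(3) and out = less.prems(4) and inn = less.prems(5)
    and link = less.prems(6)
  obtain L where L: "L \<subset> K" "L \<noteq> {}" "strong_on E L"
    and max: "\<And>M. L \<subset> M \<Longrightarrow> M \<subseteq> K \<Longrightarrow> strong_on E M \<Longrightarrow> M = K"
    using maximal_strong_proper_subset[OF less.prems(1,2)] by metis
  \<comment> \<open>A shortest ear has pairwise distinct inner vertices, by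
    \<open>ear_shortcut\<close>.\<close>
  define n where "n = (LEAST n. \<exists>f. ear E K L n f)"
  obtain f where ear: "ear E K L n f"
    using LeastI_ex[OF ear_exists[OF strong L(1,2)]] unfolding n_def by blast
  have minimal: "\<not> ear E K L m g" if "m < n" for m g
    using not_less_Least[of m "\<lambda>n. \<exists>f. ear E K L n f"] that unfolding n_def by blast
  have n2: "2 \<le> n" and ends: "f 0 \<in> L" "f n \<in> L"
    and inner: "\<And>i. 0 < i \<Longrightarrow> i < n \<Longrightarrow> f i \<in> K \<and> f i \<notin> L"
    and arc: "\<And>i. i < n \<Longrightarrow> (f i, f (Suc i)) \<in> E"
    using ear by (auto simp: ear_def)
  have inj: "i = j" if "f i = f j" "0 < i" "i < n" "0 < j" "j < n" for i j
    using ear_shortcut[OF ear, of i j] ear_shortcut[OF ear, of j i] minimal that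
    by (metis linorder_neqE_nat)
  have inK: "f i \<in> K" if "i \<le> n" for i
    using that inner[of i] ends L(1) by (cases "i = 0 \<or> i = n") auto
  define A where "A = (E \<inter> L \<times> L) \<union> {(f i, f (Suc i)) | i. i < n}"
  have AE: "A \<subseteq> E" using arc by (auto simp: A_def)
  define M where "M = L \<union> f ` {..n}"
  have reach: "(u, v) \<in> A\<^sup>*" if "u \<in> M" "v \<in> M" for u v
    using ear_arcs_strong[OF ear L(3), of A u v] that by (auto simp: A_def M_def)
  have "M = K"
  proof (rule max)
    show "L \<subset> M" using inner[of 1] n2 by (auto simp: M_def)
    show "M \<subseteq> K" using inK L(1) by (auto simp: M_def)
    have "A \<subseteq> E \<inter> M \<times> M" using arc by (auto simp: A_def M_def)
    then show "strong_on E M" using reach rtrancl_mono unfolding strong_on_def by blast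
  qed
  \<comment> \<open>\<open>A\<close> alone already connects \<open>K\<close> strongly, so any
    further arc inside \<open>K\<close> would be bypassed by a path in \<open>A\<close>.\<close>
  have arcsK: "(u, v) \<in> A" if "(u, v) \<in> E" "u \<in> K" "v \<in> K" for u v
  proof (rule ccontr)
    assume "(u, v) \<notin> A"
    then have "A\<^sup>* \<subseteq> (E - {(u, v)})\<^sup>*" using AE by (intro rtrancl_mono) auto
    then show False using reach[of u v] nontrans[of u v] that \<open>M = K\<close> by blast
  qed
  have succ: "w = f (Suc i)" if "0 < i" "i < n" "(f i, w) \<in> E" "w \<in> K" for i w
  proof -
    have "(f i, w) \<in> A" using arcsK that inner by blast
    moreover have "f i \<notin> L" using inner that by blast
    ultimately obtain j where j: "j < n" "f i = f j" "w = f (Suc j)"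
      by (auto simp: A_def)
    moreover have "j \<noteq> 0" using j ends inner[of i] that by metis
    ultimately show ?thesis using inj[of i j] that by auto
  qed
  have pred: "w = f (i - 1)" if "0 < i" "i < n" "(w, f i) \<in> E" "w \<in> K" for i w
  proof -
    have "(w, f i) \<in> A" using arcsK that inner by blast
    moreover have "f i \<notin> L" using inner that by blast
    ultimately obtain j where j: "j < n" "f i = f (Suc j)" "w = f j"
      by (auto simp: A_def)
    moreover have "Suc j \<noteq> n" using j ends inner[of i] that by metis
    ultimately show ?thesis using inj[of i "Suc j"] that by auto
  qed
  show ?case
  proof (cases "\<exists>i. 0 < i \<and> i < n \<and> f i \<notin> exits E K \<and> f i \<notin> entries E K")
    case True
    then obtain i where i: "0 < i" "i < n" "f i \<notin> exits E K" "f i \<notin> entries E K" by blast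
    have "\<exists>!w. (f i, w) \<in> E"
      using i inner[of i] succ[of i] arc[of i] unfolding exits_def by blast
    moreover have "\<exists>!w. (w, f i) \<in> E"
    proof (rule ex1I)
      show "(f (i - 1), f i) \<in> E" using i arc[of "i - 1"] by simp
      show "w = f (i - 1)" if "(w, f i) \<in> E" for w
        using i inner[of i] pred[of i w] that unfolding entries_def by blast
    qed
    ultimately show ?thesis using inner i by blast
  next
    case False
    then have cover: "f i \<in> exits E K \<or> f i \<in> entries E K" if "0 < i" "i < n" for i
      using that by blast
    \<comment> \<open>The second alternatives treat \<open>L\<close> as one member of the cyclic
      sequence. The bypass of the arc from \<open>f i\<close> to \<open>f (Suc i)\<close> goes
      within \<open>L\<close> to \<open>o'\<close> if necessary, then to \<open>e'\<close> by
      \<open>link\<close>, then within \<open>L\<close> to \<open>f (Suc i)\<close> if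
      necessary.\<close>
    have block: False
      if i: "i < n" and o: "o' \<in> exits E K" "o' = f i \<or> o' \<in> L \<and> f i \<in> L"
        and e: "e' \<in> entries E K" "e' = f (Suc i) \<or> e' \<in> L \<and> f (Suc i) \<in> L" for i o' e'
    proof -
      let ?R = "E - {(f i, f (Suc i))}"
      \<comment> \<open>An ear arc never has both ends in \<open>L\<close>, as
        \<open>2 \<le> n\<close>; so paths within \<open>L\<close> avoid it.\<close>
      have "f i \<notin> L \<or> f (Suc i) \<notin> L"
        using inner[of i] inner[of "Suc i"] i n2 by (cases "i = 0") auto
      then have "(E \<inter> L \<times> L)\<^sup>* \<subseteq> ?R\<^sup>*" by (intro rtrancl_mono) auto
      then have inL: "(x, y) \<in> ?R\<^sup>*" if "x = y \<or> x \<in> L \<and> y \<in> L" for x y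
        using that L(3) unfolding strong_on_def by blast
      have "(E - K \<times> K)\<^sup>* \<subseteq> ?R\<^sup>*"
        using inK[of i] inK[of "Suc i"] i by (intro rtrancl_mono) auto
      then have "(o', e') \<in> ?R\<^sup>*" using link[OF o(1) e(1)] by blast
      moreover have "(f i, o') \<in> ?R\<^sup>*" "(e', f (Suc i)) \<in> ?R\<^sup>*" using inL o e by auto
      ultimately have "(f i, f (Suc i)) \<in> ?R\<^sup>*" by (meson rtrancl_trans)
      then show False using nontrans[OF arc[OF i]] by blast
    qed
    have Kcases: "x \<in> L \<or> (\<exists>i. 0 < i \<and> i < n \<and> x = f i)" if "x \<in> K" for x
      using that \<open>M = K\<close> ends unfolding M_def
      by (auto simp: le_less)
    have Lo: "k \<notin> exits E K" if k: "k \<in> L" for k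
    proof
      assume ko: "k \<in> exits E K"
      \<comment> \<open>Exits spread forward: the successor of a member with an exit is no entry by
        \<open>block\<close>, hence an exit by \<open>cover\<close>.\<close>
      have all: "f i \<in> exits E K \<and> f i \<notin> entries E K" if "0 < i" "i < n" for i
        using that
      proof (induction i rule: nat_induct_non_zero)
        case 1
        then show ?case using block[of 0 k "f 1"] ko k ends cover[of 1] n2 by auto
      next
        case (Suc i)
        then show ?case using block[of i "f i" "f (Suc i)"] cover[of "Suc i"] by auto
      qed
      \<comment> \<open>No inner vertex is an entry, so an entry must lie in \<open>L\<close>; but
        the last arc of the ear runs into \<open>L\<close> from the exit
        \<open>f (n - 1)\<close>.\<close>
      obtain e where e: "e \<in> entries E K" using inn by blast
      then have "e \<in> K" by (auto simp: entries_def)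
      then have "e \<in> L" using Kcases all e by blast
      then show False using block[of "n - 1" "f (n - 1)" e] e all[of "n - 1"] ends n2 by auto
    qed
    have Li: "k \<notin> entries E K" if k: "k \<in> L" for k
    proof
      assume ki: "k \<in> entries E K"
      \<comment> \<open>Entries spread backward, so positions are counted from the end of the
        ear.\<close>
      have all: "f (n - i) \<in> entries E K \<and> f (n - i) \<notin> exits E K" if "0 < i" "i < n" for i
        using that
      proof (induction i rule: nat_induct_non_zero)
        case 1
        then show ?case
          using block[of "n - 1" "f (n - 1)" k] ki k ends cover[of "n - 1"] n2 by auto
      next
        case (Suc i)
        then have "Suc (n - Suc i) = n - i" by auto
        then show ?case
          using block[of "n - Suc i" "f (n - Suc i)" "f (n - i)"] cover[of "n - Suc i"] Suc by auto
      qed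
      obtain e where e: "e \<in> exits E K" using out by blast
      then have "e \<in> K" by (auto simp: exits_def)
      moreover have "e \<noteq> f i" if "0 < i" "i < n" for i
        using all[of "n - i"] that e by auto
      ultimately have "e \<in> L" using Kcases by blast
      \<comment> \<open>Taking \<open>i = n - 1\<close> in \<open>all\<close> makes
        \<open>f 1\<close> an entry, while the exit \<open>e\<close> lies in \<open>L\<close> just
        before it.\<close>
      then show False using block[of 0 e "f 1"] e all[of "n - 1"] ends n2 by auto
    qed
    \<comment> \<open>An arc leaving \<open>L\<close> stays in \<open>K\<close> by
      \<open>Lo\<close>, hence is an ear arc; its tail lies in \<open>L\<close>, so it is the first
      one.\<close>
    have outL: "u = f 0 \<and> w = f 1" if "u \<in> L" "w \<notin> L" "(u, w) \<in> E" for u w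
    proof -
      have "w \<in> K" using Lo that L(1) unfolding exits_def by blast
      then have "(u, w) \<in> A" using arcsK that L(1) by blast
      then obtain j where "j < n" "u = f j" "w = f (Suc j)"
        using \<open>w \<notin> L\<close> by (auto simp: A_def)
      then show ?thesis using inner[of j] that by (cases j) auto
    qed
    have inL: "u = f n \<and> w = f (n - 1)" if "u \<in> L" "w \<notin> L" "(w, u) \<in> E" for u w
    proof -
      have "w \<in> K" using Li that L(1) unfolding entries_def by blast
      then have "(w, u) \<in> A" using arcsK that L(1) by blast
      then obtain j where "j < n" "w = f j" "u = f (Suc j)"
        using \<open>w \<notin> L\<close> by (auto simp: A_def)
      then show ?thesis using inner[of "Suc j"] that by (cases "Suc j = n") auto
    qed
    have first: "f 1 \<notin> L" "(f 0, f 1) \<in> E" using inner[of 1] arc[of 0] n2 by auto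
    have last: "f (n - 1) \<notin> L" "(f (n - 1), f n) \<in> E"
      using inner[of "n - 1"] arc[of "n - 1"] n2 by auto
    show ?thesis
    proof (cases "card L = 1")
      case True
      then have single: "L = {f 0}" "f n = f 0" using ends by (auto simp: card_1_singleton_iff)
      \<comment> \<open>A neighbour in \<open>L\<close> would be \<open>f 0\<close> itself, and
        there are no loops.\<close>
      have "w \<notin> L" if "(f 0, w) \<in> E \<or> (w, f 0) \<in> E" for w
        using that nontrans[of w w] single by auto
      then have "\<And>w. (f 0, w) \<in> E \<longleftrightarrow> w = f 1" "\<And>w. (w, f 0) \<in> E \<longleftrightarrow> w = f (n - 1)"
        using outL[OF ends(1)] inL[OF ends(1)] first(2) last(2) single(2) by metis+
      then have "(\<exists>!w. (f 0, w) \<in> E) \<and> (\<exists>!w. (w, f 0) \<in> E)" by simp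
      then show ?thesis using inK by blast
    next
      case False
      have finL: "finite L" using fin L(1) finite_subset by blast
      \<comment> \<open>The ear itself supplies the link outside \<open>L\<close> from its only exit
        \<open>f 0\<close> to its only entry \<open>f n\<close>.\<close>
      have "(f 0, f i) \<in> (E - L \<times> L)\<^sup>*" if "i \<le> n" for i
        using that
      proof (induction i)
        case (Suc i)
        have "f i \<notin> L \<or> f (Suc i) \<notin> L"
          using inner[of i] inner[of "Suc i"] Suc.prems n2 by (cases "i = 0") auto
        then show ?case using Suc arc[of i] by (auto intro: rtrancl_into_rtrancl)
      qed auto
      then have "(f 0, f n) \<in> (E - L \<times> L)\<^sup>*" by blast
      moreover have "exits E L = {f 0}" "entries E L = {f n}"
        using outL inL first last ends unfolding exits_def entries_def by blast+
      moreover have "card L < card K" using psubset_card_mono[OF fin L(1)] .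
      moreover have "2 \<le> card L"
        using False finL L(2) card_gt_0_iff[of L] by linarith
      ultimately have "\<exists>v\<in>L. (\<exists>!w. (v, w) \<in> E) \<and> (\<exists>!w. (w, v) \<in> E)"
        using less.hyps[of L] finL L(3) by auto
      then show ?thesis using L(1) by blast
    qed
  qed
qed

section \<open>From a convex set to the deleted arcs and back\<close>

lemma exit_reaches_deleted_arcs:
  assumes u: "u \<in> exits E K" and B: "fst ` B \<subseteq> X"
    and returns: "\<And>w. (u, w) \<in> E \<Longrightarrow> (w, u) \<in> E\<^sup>*"
    and convex: "\<And>x y z. x \<in> K \<Longrightarrow> y \<in> K \<Longrightarrow> (x, z) \<in> (E - B)\<^sup>* \<Longrightarrow> (z, y) \<in> (E - B)\<^sup>* \<Longrightarrow> z \<in> K"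
  shows "\<exists>x\<in>X. (u, x) \<in> (E - K \<times> K)\<^sup>*"
proof (cases "u \<in> X")
  case False
  obtain w where w: "u \<in> K" "w \<notin> K" "(u, w) \<in> E" using u by (auto simp: exits_def)
  then have uw: "(u, w) \<in> E - B" using False B by force
  let ?Y = "{y. (w, y) \<in> (E - B)\<^sup>*}"
  \<comment> \<open>By convexity a path in \<open>E - B\<close> that has left \<open>K\<close> never
    returns. So it uses no arc inside \<open>K\<close>.\<close>
  have YK: "y \<notin> K" if "y \<in> ?Y" for y
    using convex[of u y w] that uw w by blast
  have avoid: "(w, y) \<in> (E - K \<times> K)\<^sup>*" if "(w, y) \<in> (E - B)\<^sup>*" for y
    using that
  proof (induction rule: rtrancl_induct)
    case (step y z)
    then have "y \<notin> K" using YK by blast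
    then show ?case using step by (auto intro: rtrancl_into_rtrancl)
  qed simp
  \<comment> \<open>The way from \<open>w\<close> back to \<open>u\<close> in \<open>E\<close> must
    leave \<open>?Y\<close>, which only an arc of \<open>B\<close> can do; its tail is the vertex of
    \<open>X\<close> sought.\<close>
  obtain y z where yz: "(y, z) \<in> E" "y \<in> ?Y" "z \<notin> ?Y"
    using path_crosses[OF returns[OF w(3)], of ?Y] YK[of u] w by auto
  then have "(y, z) \<in> B" by (auto intro: rtrancl_into_rtrancl)
  then have "y \<in> X" using B by force
  moreover have "(u, y) \<in> (E - K \<times> K)\<^sup>*"
    using avoid[of y] yz w by (auto intro: converse_rtrancl_into_rtrancl)
  ultimately show ?thesis by blast
qed auto

text \<open>Reversing all arcs turns entries into exits and preserves convexity, so the previous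
  lemma applies.\<close>

lemma entry_reached_from_deleted_arcs:
  assumes v: "v \<in> entries E K" and B: "snd ` B \<subseteq> X"
    and returns: "\<And>w. (w, v) \<in> E \<Longrightarrow> (v, w) \<in> E\<^sup>*"
    and convex: "\<And>x y z. x \<in> K \<Longrightarrow> y \<in> K \<Longrightarrow> (x, z) \<in> (E - B)\<^sup>* \<Longrightarrow> (z, y) \<in> (E - B)\<^sup>* \<Longrightarrow> z \<in> K"
  shows "\<exists>x\<in>X. (x, v) \<in> (E - K \<times> K)\<^sup>*"
proof -
  have eq: "E\<inverse> - B\<inverse> = (E - B)\<inverse>" "E\<inverse> - K \<times> K = (E - K \<times> K)\<inverse>" by auto
  have "\<exists>x\<in>X. (v, x) \<in> (E\<inverse> - K \<times> K)\<^sup>*"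
  proof (rule exit_reaches_deleted_arcs)
    show "v \<in> exits (E\<inverse>) K" using v by (auto simp: exits_def entries_def)
    show "fst ` (B\<inverse>) \<subseteq> X" using B by force
    show "(w, v) \<in> (E\<inverse>)\<^sup>*" if "(v, w) \<in> E\<inverse>" for w
      using returns that by (simp add: rtrancl_converse)
    show "z \<in> K" if "x \<in> K" "y \<in> K" "(x, z) \<in> (E\<inverse> - B\<inverse>)\<^sup>*" "(z, y) \<in> (E\<inverse> - B\<inverse>)\<^sup>*" for x y z
      using convex[of y x z] that unfolding eq by (simp add: rtrancl_converse)
  qed
  then show ?thesis unfolding eq by (simp add: rtrancl_converse)
qed

section \<open>From arc lists and digraphs to relations\<close>

lemma (in pre_digraph) cas_arcs_rtrancl:
  assumes "cas u p v" "e \<in> set p"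
  shows "(u, tail G e) \<in> ((\<lambda>e. (tail G e, head G e)) ` set p)\<^sup>*"
    and "(head G e, v) \<in> ((\<lambda>e. (tail G e, head G e)) ` set p)\<^sup>*"
    and "head G e \<in> insert v (tail G ` set p)"
proof -
  let ?B = "\<lambda>p. (\<lambda>e. (tail G e, head G e)) ` set p"
  have sub: "(?B p)\<^sup>* \<subseteq> (?B (a # p))\<^sup>*" for a p by (intro rtrancl_mono) auto
  \<comment> \<open>The path from \<open>u\<close> to \<open>v\<close> is added to strengthen the
    induction. An empty rest is treated apart below, because the hypothesis needs an arc in
    it.\<close>
  have "(u, tail G e) \<in> (?B p)\<^sup>* \<and> (u, v) \<in> (?B p)\<^sup>* \<and> (head G e, v) \<in> (?B p)\<^sup>*
      \<and> head G e \<in> insert v (tail G ` set p)"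
    using assms
  proof (induction p arbitrary: u e)
    case (Cons a p)
    then have a: "tail G a = u" "cas (head G a) p v" by auto
    have first: "(u, head G a) \<in> (?B (a # p))\<^sup>*" using a by auto
    show ?case
    proof (cases p)
      case Nil
      then show ?thesis using Cons.prems by auto
    next
      case (Cons b q)
      then have "b \<in> set p" "tail G b = head G a" using a by auto
      note IH = Cons.IH[OF a(2)]
      have "(head G a, v) \<in> (?B (a # p))\<^sup>*" using IH[OF \<open>b \<in> set p\<close>] sub by blast
      then have uv: "(u, v) \<in> (?B (a # p))\<^sup>*" using first by (meson rtrancl_trans)
      show ?thesis
      proof (cases "e = a")
        case True
        then show ?thesis
          using a uv \<open>(head G a, v) \<in> _\<close> \<open>b \<in> set p\<close> \<open>tail G b = head G a\<close> by force
      next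
        case False
        then have "e \<in> set p" using Cons.prems by simp
        from IH[OF this] sub[of p a] have "(head G a, tail G e) \<in> (?B (a # p))\<^sup>*"
          "(head G e, v) \<in> (?B (a # p))\<^sup>*" "head G e \<in> insert v (tail G ` set (a # p))" by auto
        then show ?thesis using uv first by (meson rtrancl_trans)
      qed
    qed
  qed simp
  then show "(u, tail G e) \<in> (?B p)\<^sup>*" "(head G e, v) \<in> (?B p)\<^sup>*"
    "head G e \<in> insert v (tail G ` set p)" by auto
qed

text \<open>Any two vertices are joined through the base point \<open>u\<close> of the closed walk.
  The first claim is needed because \<open>cycle_verts\<close> collects only tails.\<close>

lemma (in pre_digraph) cycle_strong:
  assumes "cycle c"
  defines "B \<equiv> (\<lambda>e. (tail G e, head G e)) ` set c"
  shows "head G ` set c \<subseteq> cycle_verts G c"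
    and "x \<in> cycle_verts G c \<Longrightarrow> y \<in> cycle_verts G c \<Longrightarrow> (x, y) \<in> B\<^sup>*"
proof -
  obtain u where u: "cas u c u" "c \<noteq> []" using assms(1) by (auto simp: cycle_def awalk_def)
  then have "u \<in> tail G ` set c" by (cases c) auto
  then show "head G ` set c \<subseteq> cycle_verts G c"
    using cas_arcs_rtrancl(3)[OF u(1)] by (auto simp: cycle_verts_def)
  assume "x \<in> cycle_verts G c" "y \<in> cycle_verts G c"
  then obtain e e' where e: "e \<in> set c" "x = tail G e" "e' \<in> set c" "y = tail G e'"
    by (auto simp: cycle_verts_def)
  then have "(x, head G e) \<in> B" by (auto simp: B_def)
  moreover have "(head G e, u) \<in> B\<^sup>*" "(u, y) \<in> B\<^sup>*"
    using cas_arcs_rtrancl[OF u(1)] e unfolding B_def by auto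
  ultimately show "(x, y) \<in> B\<^sup>*" by (meson converse_rtrancl_into_rtrancl rtrancl_trans)
qed

lemma (in wf_digraph) rtrancl_minus_awalk:
  assumes "(x, y) \<in> (arcs_ends G - {(tail G e, head G e)})\<^sup>*" "x \<in> verts G"
  shows "\<exists>p. awalk x p y \<and> e \<notin> set p"
  using assms
proof (induction rule: converse_rtrancl_induct)
  case base
  then show ?case by (intro exI[of _ "[]"]) (simp add: awalk_Nil_iff)
next
  case (step x z)
  then obtain a where a: "a \<in> arcs G" "tail G a = x" "head G a = z" "a \<noteq> e"
    by (auto simp: arcs_ends_conv)
  then obtain p where "awalk z p y" "e \<notin> set p" using step.IH by auto
  then show ?case using a by (intro exI[of _ "a # p"]) (auto simp: awalk_Cons_iff)
qed

text \<open>A bypass in the relation gives a walk without the arc; shortening it to a path adds no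
  arcs, so the arc would be transitive.\<close>

lemma minimal_strong_digraph_no_bypass:
  assumes "minimal_strong_digraph G" "(u, v) \<in> arcs_ends G"
  shows "(u, v) \<notin> (arcs_ends G - {(u, v)})\<^sup>*"
proof
  interpret digraph G using assms by (simp add: minimal_strong_digraph_def)
  assume bypass: "(u, v) \<in> (arcs_ends G - {(u, v)})\<^sup>*"
  obtain e where e: "e \<in> arcs G" "tail G e = u" "head G e = v"
    using assms(2) by (auto simp: arcs_ends_conv)
  then obtain p where p: "awalk u p v" "e \<notin> set p"
    using rtrancl_minus_awalk[of u v e] bypass by auto
  then have "apath u (awalk_to_apath p) v" "e \<notin> set (awalk_to_apath p)"
    using apath_awalk_to_apath awalk_to_apath_subset by blast+
  then have "transitive_arc G e" using e by (auto simp: transitive_arc_def)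
  then show False using assms(1) e by (auto simp: minimal_strong_digraph_def)
qed

text \<open>Without parallel arcs a unique neighbour means a unique arc.\<close>

lemma (in digraph) linear_vertexI:
  assumes "\<exists>!w. (v, w) \<in> arcs_ends G" "\<exists>!w. (w, v) \<in> arcs_ends G"
  shows "linear_vertex G v"
proof -
  obtain w where w: "(v, w) \<in> arcs_ends G" "\<And>x. (v, x) \<in> arcs_ends G \<Longrightarrow> x = w"
    using assms(1) by blast
  obtain e where e: "e \<in> arcs G" "tail G e = v" "head G e = w"
    using w(1) by (auto simp: arcs_ends_conv)
  have "out_arcs G v = {e}"
  proof -
    have "a = e" if "a \<in> out_arcs G v" for a
    proof -
      have "(v, head G a) \<in> arcs_ends G" using that by (auto dest: in_arcs_imp_in_arcs_ends)
      from w(2)[OF this] show ?thesis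
        using that e no_multi_arcs[of a e] by (auto simp: arc_to_ends_def)
    qed
    moreover have "e \<in> out_arcs G v" using e by simp
    ultimately show ?thesis by blast
  qed
  moreover obtain w' where w': "(w', v) \<in> arcs_ends G" "\<And>x. (x, v) \<in> arcs_ends G \<Longrightarrow> x = w'"
    using assms(2) by blast
  obtain e' where e': "e' \<in> arcs G" "tail G e' = w'" "head G e' = v"
    using w'(1) by (auto simp: arcs_ends_conv)
  have "in_arcs G v = {e'}"
  proof -
    have "a = e'" if "a \<in> in_arcs G v" for a
    proof -
      have "(tail G a, v) \<in> arcs_ends G" using that by (auto dest: in_arcs_imp_in_arcs_ends)
      from w'(2)[OF this] show ?thesis
        using that e' no_multi_arcs[of a e'] by (auto simp: arc_to_ends_def)
    qed
    moreover have "e' \<in> in_arcs G v" using e' by simp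
    ultimately show ?thesis by blast
  qed
  ultimately show ?thesis using e by (auto simp: linear_vertex_def in_degree_def out_degree_def)
qed

section \<open>Application to a strong component\<close>

theorem theorem1:
  fixes D D' S :: "('a, 'b) pre_digraph" and c :: "'b list" and q :: nat
  assumes "minimal_strong_digraph D"
    and "pre_digraph.cycle D c" and "length c = q" and "q \<ge> 2"
    and "D' = del_arcs D (set c)"
    and "strong_component D' S" and "nontrivial S"
    and "card (verts S \<inter> cycle_verts D c) \<le> 1"
  shows "\<exists>v \<in> verts S. linear_vertex D v"
proof -
  interpret D: digraph D using assms(1) by (simp add: minimal_strong_digraph_def)
  interpret D': wf_digraph D'
    by unfold_locales (auto simp: assms(5) del_arcs_def)
  define E where "E = arcs_ends D"
  define B where "B = (\<lambda>e. (tail D e, head D e)) ` set c"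
  define K where "K = verts S"
  define X where "X = cycle_verts D c"
  have cD: "set c \<subseteq> arcs D" "c \<noteq> []"
    using assms(2) by (auto simp: D.cycle_def D.awalk_def)
  have BE: "B \<subseteq> E" using cD by (auto simp: B_def E_def arcs_ends_conv)
  \<comment> \<open>Without parallel arcs, no other arc keeps the pair of a deleted one.\<close>
  have E': "arcs_ends D' = E - B"
  proof -
    have "inj_on (arc_to_ends D) (arcs D)" using D.no_multi_arcs by (auto intro: inj_onI)
    then have "arc_to_ends D ` (arcs D - set c) = arc_to_ends D ` arcs D - arc_to_ends D ` set c"
      using cD(1) by (intro inj_on_image_set_diff[of _ "arcs D"]) auto
    then show ?thesis
      by (simp add: assms(5) del_arcs_def E_def B_def arcs_ends_def arc_to_ends_def)
  qed
  have sub: "subgraph S D'" "strongly_connected S"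
    using assms(6) by (auto simp: D'.max_subgraph_def)
  interpret S: wf_digraph S using sub(1) by (auto simp: subgraph_def)
  have KV: "K \<subseteq> verts D" using sub(1) by (auto simp: K_def subgraph_def assms(5) del_arcs_def)
  have finK: "finite K" using KV by (rule finite_subset) simp
  have "K \<noteq> {}" using sub(2) by (auto simp: K_def strongly_connected_def)
  then have "0 < card K" using finK by (simp add: card_gt_0_iff)
  then have card2: "2 \<le> card K" using assms(7) by (simp add: nontrivial_def K_def)
  have XV: "X \<subseteq> verts D" using cD by (auto simp: X_def cycle_verts_def)
  have headX: "head D ` set c \<subseteq> X" unfolding X_def by (rule D.cycle_strong(1)[OF assms(2)])
  have BX: "fst ` B \<subseteq> X" "snd ` B \<subseteq> X"
    using headX by (auto simp: B_def X_def cycle_verts_def)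
  have one: "x = y" if "x \<in> K \<inter> X" "y \<in> K \<inter> X" for x y
    using that assms(8) card_le_Suc0_iff_eq[of "K \<inter> X"] finK by (auto simp: K_def X_def)
  \<comment> \<open>A cycle arc inside \<open>K\<close> would have equal ends, since
    \<open>K\<close> meets the cycle at most once.\<close>
  have BK: "B \<inter> K \<times> K = {}"
  proof (rule ccontr)
    assume "B \<inter> K \<times> K \<noteq> {}"
    then obtain e where e: "e \<in> set c" "tail D e \<in> K" "head D e \<in> K" by (auto simp: B_def)
    then have "tail D e = head D e"
      using headX by (intro one) (auto simp: X_def cycle_verts_def)
    then show False using D.no_loops[of e] e cD by auto
  qed
  obtain x0 where x0: "x0 \<in> X" "x0 \<notin> K"
  proof -
    have "hd c \<in> set c" using cD by simp
    then have "(tail D (hd c), head D (hd c)) \<in> B" by (auto simp: B_def)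
    then show ?thesis using BK BX that by force
  qed
  have conn: "(x, y) \<in> E\<^sup>*" if "x \<in> verts D" "y \<in> verts D" for x y
    using that assms(1) unfolding E_def minimal_strong_digraph_def strongly_connected_def
    by (intro reachable_rtranclI) auto
  have EV: "x \<in> verts D" "y \<in> verts D" if "(x, y) \<in> E" for x y
    using that by (auto simp: E_def arcs_ends_conv)
  \<comment> \<open>\<open>K\<close> is a class of mutual reachability in \<open>D'\<close>, and
    \<open>z\<close> lies on a closed walk through \<open>K\<close>.\<close>
  have convex: "z \<in> K" if "x \<in> K" "y \<in> K" "(x, z) \<in> (E - B)\<^sup>*" "(z, y) \<in> (E - B)\<^sup>*" for x y z
  proof -
    have scc: "K \<in> D'.sccs_verts"
      using D'.in_sccs_vertsI_sccs assms(6) unfolding D'.sccs_altdef2 K_def by blast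
    have V': "verts D' = verts D" by (simp add: assms(5) del_arcs_def)
    have "x \<rightarrow>\<^sup>*\<^bsub>D'\<^esub> z" "z \<rightarrow>\<^sup>*\<^bsub>D'\<^esub> y"
    proof -
      show "x \<rightarrow>\<^sup>*\<^bsub>D'\<^esub> z" using that KV V' by (auto simp: D'.reachable_conv' E')
      then have "z \<in> verts D'" by (rule D'.reachable_in_verts)
      then show "z \<rightarrow>\<^sup>*\<^bsub>D'\<^esub> y" using that by (auto simp: D'.reachable_conv' E')
    qed
    moreover have "y \<rightarrow>\<^sup>*\<^bsub>D'\<^esub> x" using scc that by (simp add: D'.in_sccs_verts_conv_reachable)
    ultimately show ?thesis
      using scc that D'.reachable_trans unfolding D'.in_sccs_verts_conv_reachable by blast
  qed
  have "\<exists>v\<in>K. (\<exists>!w. (v, w) \<in> E) \<and> (\<exists>!w. (w, v) \<in> E)"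
  proof (rule strong_set_has_linear_vertex[OF _ finK card2])
    show "(u, v) \<notin> (E - {(u, v)})\<^sup>*" if "(u, v) \<in> E" for u v
      using minimal_strong_digraph_no_bypass[OF assms(1)] that by (simp add: E_def)
    have "arcs_ends S \<subseteq> arcs_ends D'"
      using sub(1) by (auto simp: arcs_ends_conv subgraph_def compatible_def)
    moreover have "arcs_ends S \<subseteq> K \<times> K" by (auto simp: arcs_ends_conv K_def)
    ultimately have "(arcs_ends S)\<^sup>* \<subseteq> (E \<inter> K \<times> K)\<^sup>*"
      unfolding E' by (intro rtrancl_mono) auto
    then show "strong_on E K"
      using sub(2) reachable_rtranclI[where G = S]
      unfolding strong_on_def strongly_connected_def K_def by blast
    obtain k where k: "k \<in> K" using \<open>K \<noteq> {}\<close> by blast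
    \<comment> \<open>The cycle vertex \<open>x0\<close> outside \<open>K\<close> forces paths out
      of \<open>K\<close> and into \<open>K\<close>.\<close>
    show "exits E K \<noteq> {}"
      using path_crosses[OF conn[of k x0], of K] k x0 XV KV unfolding exits_def by blast
    show "entries E K \<noteq> {}"
      using path_crosses[OF conn[of x0 k], of "- K"] k x0 XV KV unfolding entries_def by blast
    fix u v assume u: "u \<in> exits E K" and v: "v \<in> entries E K"
    obtain x where x: "x \<in> X" "(u, x) \<in> (E - K \<times> K)\<^sup>*"
      using exit_reaches_deleted_arcs[OF u BX(1)] conn convex EV by metis
    obtain y where y: "y \<in> X" "(y, v) \<in> (E - K \<times> K)\<^sup>*"
      using entry_reached_from_deleted_arcs[OF v BX(2)] conn convex EV by metis
    \<comment> \<open>The two outer paths are joined along the cycle, none of whose arcs lies inside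
      \<open>K\<close>.\<close>
    have "(x, y) \<in> B\<^sup>*"
      using D.cycle_strong(2)[OF assms(2)] x y by (simp add: X_def B_def)
    moreover have "B\<^sup>* \<subseteq> (E - K \<times> K)\<^sup>*" using BE BK by (intro rtrancl_mono) auto
    ultimately show "(u, v) \<in> (E - K \<times> K)\<^sup>*" using x(2) y(2) by (meson rtrancl_trans subsetD)
  qed
  then obtain v where "v \<in> verts S" "linear_vertex D v"
    unfolding E_def K_def by (elim bexE conjE) (rule that, assumption, rule D.linear_vertexI)
  then show ?thesis by (rule bexI[rotated])
qed

end
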